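(* Let $(\mathcal{T},\Gamma)$ be a $0$-simple $\Gamma$-semigroup. Then $(\mathcal{T},\Gamma)$ is completely $0$-simple if and only if it contains at least one $0$-least $\Gamma$-left ideal and at least one $0$-least $\Gamma$-right ideal.
   Context: A $\Gamma$-semigroup $(\mathcal{T},\Gamma)$ consists of non-empty sets $\mathcal{T},\Gamma$ and a map $\mathcal{T}\times\Gamma\times\mathcal{T}\to\mathcal{T}$, $(e,\alpha,f)\mapsto [e\alpha f]=e\alpha f$, with $(e\alpha f)\beta g=e\alpha(f\beta g)$ for all $e,f,g\in\mathcal{T}$, $\alpha,\beta\in\Gamma$. For $A,B\subseteq\mathcal{T}$ put $[A\Gamma B]=\{a\gamma b: a\in A,\gamma\in\Gamma,b\in B\}$. A zero is an element $0\in\mathcal{T}$ with $e\gamma 0=0\gamma e=0$ for all $e\in\mathcal{T},\gamma\in\Gamma$. A non-empty $B\subseteq\mathcal{T}$ is a $\Gamma$-left ideal if $[\mathcal{T}\Gamma B]\subseteq B$, a $\Gamma$-right ideal if $[B\Gamma\mathcal{T}]\subseteq B$, and a $\Gamma$-2-sided ideal if both hold. A $\Gamma$-semigroup with zero is $0$-simple (also called 0-2-sided simple) if $[\mathcal{T}\Gamma\mathcal{T}]\neq\{0\}$ and its only $\Gamma$-2-sided ideals are $\{0\}$ and $\mathcal{T}$. A $0$-least $\Gamma$-left (right) ideal is a $\Gamma$-left (right) ideal $B\neq\{0\}$ such that the only $\Gamma$-left (right) ideal of $\mathcal{T}$ properly contained in $B$ is $\{0\}$. An element $e$ is an idempotent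 if $e\alpha e=e$ for some $\alpha\in\Gamma$. For idempotents $e,f$, the order $e\le f$ is defined to mean that there exist $x,y\in\Gamma$ with $[exf]=[fye]=e$. An idempotent is primitive if it is non-zero and is minimal, with respect to $\le$, in the set of non-zero idempotents. A $0$-simple $\Gamma$-semigroup is completely $0$-simple if it contains a primitive idempotent. *)

theory Defs
  imports Main
begin

locale gamma_semigroup =
  fixes T :: "'a set" and \<Gamma> :: "'g set" and mult :: "'a \<Rightarrow> 'g \<Rightarrow> 'a \<Rightarrow> 'a"
  assumes T_nonempty: "T \<noteq> {}"
    and Gamma_nonempty: "\<Gamma> \<noteq> {}"
    and mult_closed: "\<lbrakk>e \<in> T; \<alpha> \<in> \<Gamma>; f \<in> T\<rbrakk> \<Longrightarrow> mult e \<alpha> f \<in> T"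
    and mult_assoc: "\<lbrakk>e \<in> T; f \<in> T; g \<in> T; \<alpha> \<in> \<Gamma>; \<beta> \<in> \<Gamma>\<rbrakk>
      \<Longrightarrow> mult (mult e \<alpha> f) \<beta> g = mult e \<alpha> (mult f \<beta> g)"
begin

definition set_mult :: "'a set \<Rightarrow> 'a set \<Rightarrow> 'a set" where
  "set_mult A B = {mult a \<gamma> b | a \<gamma> b. a \<in> A \<and> \<gamma> \<in> \<Gamma> \<and> b \<in> B}"

definition left_ideal :: "'a set \<Rightarrow> bool" where
  "left_ideal B \<longleftrightarrow> B \<noteq> {} \<and> B \<subseteq> T \<and> set_mult T B \<subseteq> B"

definition right_ideal :: "'a set \<Rightarrow> bool" where
  "right_ideal B \<longleftrightarrow> B \<noteq> {} \<and> B \<subseteq> T \<and> set_mult B T \<subseteq> B"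

definition two_sided_ideal :: "'a set \<Rightarrow> bool" where
  "two_sided_ideal B \<longleftrightarrow> left_ideal B \<and> right_ideal B"

definition idempotent :: "'a \<Rightarrow> bool" where
  "idempotent e \<longleftrightarrow> e \<in> T \<and> (\<exists>\<alpha>\<in>\<Gamma>. mult e \<alpha> e = e)"

definition idem_le :: "'a \<Rightarrow> 'a \<Rightarrow> bool" where
  "idem_le e f \<longleftrightarrow> (\<exists>x\<in>\<Gamma>. \<exists>y\<in>\<Gamma>. mult e x f = e \<and> mult f y e = e)"

end

locale gamma_semigroup_with_zero = gamma_semigroup T \<Gamma> mult
  for T :: "'a set" and \<Gamma> :: "'g set" and mult :: "'a \<Rightarrow> 'g \<Rightarrow> 'a \<Rightarrow> 'a" +
  fixes zero :: 'a
  assumes zero_in_T: "zero \<in> T"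
    and mult_zero_right: "\<lbrakk>e \<in> T; \<gamma> \<in> \<Gamma>\<rbrakk> \<Longrightarrow> mult e \<gamma> zero = zero"
    and mult_zero_left: "\<lbrakk>e \<in> T; \<gamma> \<in> \<Gamma>\<rbrakk> \<Longrightarrow> mult zero \<gamma> e = zero"
begin

definition zero_least_left_ideal :: "'a set \<Rightarrow> bool" where
  "zero_least_left_ideal B \<longleftrightarrow>
     left_ideal B \<and> B \<noteq> {zero} \<and> (\<forall>C. left_ideal C \<and> C \<subset> B \<longrightarrow> C = {zero})"

definition zero_least_right_ideal :: "'a set \<Rightarrow> bool" where
  "zero_least_right_ideal B \<longleftrightarrow>
     right_ideal B \<and> B \<noteq> {zero} \<and> (\<forall>C. right_ideal C \<and> C \<subset> B \<longrightarrow> C = {zero})"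

text \<open>The relation \<open>idem_le\<close> is reflexive and transitive on idempotents but not antisymmetric:
  if \<open>T\<close> is a group with a zero adjoined, \<open>\<Gamma>\<close> is that group and \<open>mult\<close> is the triple product, then
  all non-zero elements are idempotents lying below each other. Minimality is therefore that of a
  preorder: no element of the set is strictly below \<open>e\<close>, where \<open>f\<close> strictly below \<open>e\<close>
  means \<open>idem_le f e\<close> and not \<open>idem_le e f\<close>.\<close>

definition primitive_idempotent :: "'a \<Rightarrow> bool" where
  "primitive_idempotent e \<longleftrightarrow>
     idempotent e \<and> e \<noteq> zero \<and>
     (\<forall>f. idempotent f \<and> f \<noteq> zero \<and> idem_le f e \<longrightarrow> idem_le e f)"

end

locale zero_simple_gamma_semigroup = gamma_semigroup_with_zero T \<Gamma> mult zero
  for T :: "'a set" and \<Gamma> :: "'g set" and mult :: "'a \<Rightarrow> 'g \<Rightarrow> 'a \<Rightarrow> 'a" and zero :: 'a +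
  assumes square_nonzero: "set_mult T T \<noteq> {zero}"
    and only_two_sided_ideals: "two_sided_ideal B \<Longrightarrow> B = {zero} \<or> B = T"

locale completely_zero_simple_gamma_semigroup = zero_simple_gamma_semigroup T \<Gamma> mult zero
  for T :: "'a set" and \<Gamma> :: "'g set" and mult :: "'a \<Rightarrow> 'g \<Rightarrow> 'a \<Rightarrow> 'a" and zero :: 'a +
  assumes ex_primitive_idempotent: "\<exists>e. primitive_idempotent e"

end

theory Submission
  imports Defs
begin

text \<open>Everything rests on the fact that in a 0-simple \<open>\<Gamma>\<close>-semigroup each element \<open>t\<close> can be written
  \<open>x \<gamma> a \<delta> y\<close>, for any given \<open>a \<noteq> 0\<close>.

  If \<open>e = e \<alpha> e\<close> is primitive and \<open>a \<noteq> 0\<close> satisfies \<open>a = e \<alpha> a = a \<alpha> e\<close>, write \<open>e = x \<alpha> a \<alpha> y\<close> with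
  \<open>x\<close>, \<open>y\<close> in \<open>e \<alpha> T \<alpha> e\<close>. Then \<open>y \<alpha> x \<alpha> a\<close> is a non-zero idempotent below \<open>e\<close>, and primitivity makes
  \<open>a\<close> left invertible. Since every non-zero left ideal inside \<open>T \<Gamma> e\<close> contains such an \<open>a\<close>, it
  contains \<open>e\<close>, so \<open>T \<Gamma> e\<close> is 0-least.

  Conversely, translating a 0-least left ideal \<open>L\<close> by an element \<open>s\<close> keeps it 0-least, so one may
  assume \<open>L \<Gamma> R \<noteq> 0\<close>. This yields \<open>a\<close> in \<open>L \<inter> R\<close> and \<open>\<beta>\<close> with \<open>a \<beta> a \<noteq> 0\<close>; minimality gives
  \<open>a = v \<beta> a \<beta> a = a \<beta> a \<beta> w\<close>, and \<open>e = v \<beta> a = a \<beta> w\<close> is idempotent. It is primitive since any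
  non-zero idempotent below \<open>e\<close> again generates both \<open>L\<close> and \<open>R\<close>.\<close>

section \<open>Left ideals: translates and principal left ideals\<close>

context gamma_semigroup
begin

lemma left_idealI:
  assumes "B \<noteq> {}" "B \<subseteq> T"
    and "\<And>t \<gamma> b. \<lbrakk>t \<in> T; \<gamma> \<in> \<Gamma>; b \<in> B\<rbrakk> \<Longrightarrow> mult t \<gamma> b \<in> B"
  shows "left_ideal B"
  using assms unfolding left_ideal_def set_mult_def by blast

lemma left_idealD:
  assumes "left_ideal B"
  shows "B \<noteq> {}" "B \<subseteq> T" "\<lbrakk>t \<in> T; \<gamma> \<in> \<Gamma>; b \<in> B\<rbrakk> \<Longrightarrow> mult t \<gamma> b \<in> B"
  using assms unfolding left_ideal_def set_mult_def by blast+

lemma two_sided_idealI: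
  assumes "B \<noteq> {}" "B \<subseteq> T"
    and "\<And>t \<gamma> b. \<lbrakk>t \<in> T; \<gamma> \<in> \<Gamma>; b \<in> B\<rbrakk> \<Longrightarrow> mult t \<gamma> b \<in> B"
    and "\<And>t \<gamma> b. \<lbrakk>t \<in> T; \<gamma> \<in> \<Gamma>; b \<in> B\<rbrakk> \<Longrightarrow> mult b \<gamma> t \<in> B"
  shows "two_sided_ideal B"
  using assms unfolding two_sided_ideal_def left_ideal_def right_ideal_def set_mult_def by blast

lemma left_ideal_translate:
  assumes "left_ideal L" "\<gamma> \<in> \<Gamma>" "s \<in> T"
  shows "left_ideal ((\<lambda>x. mult x \<gamma> s) ` L)"
proof (rule left_idealI)
  show "(\<lambda>x. mult x \<gamma> s) ` L \<noteq> {}" using left_idealD(1)[OF assms(1)] by simp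
  show "(\<lambda>x. mult x \<gamma> s) ` L \<subseteq> T" using left_idealD(2)[OF assms(1)] assms mult_closed by blast
next
  fix t \<delta> b assume *: "t \<in> T" "\<delta> \<in> \<Gamma>" "b \<in> (\<lambda>x. mult x \<gamma> s) ` L"
  then obtain x where x: "x \<in> L" "b = mult x \<gamma> s" by blast
  have "mult t \<delta> b = mult (mult t \<delta> x) \<gamma> s"
    using * x left_idealD(2)[OF assms(1)] assms mult_assoc by auto
  then show "mult t \<delta> b \<in> (\<lambda>x. mult x \<gamma> s) ` L"
    using left_idealD(3)[OF assms(1) *(1,2) x(1)] by blast
qed

lemma left_ideal_principal:
  assumes "a \<in> T"
  shows "left_ideal {mult t \<gamma> a | t \<gamma>. t \<in> T \<and> \<gamma> \<in> \<Gamma>}"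
proof (rule left_idealI)
  fix t \<delta> b assume *: "t \<in> T" "\<delta> \<in> \<Gamma>" "b \<in> {mult t \<gamma> a | t \<gamma>. t \<in> T \<and> \<gamma> \<in> \<Gamma>}"
  then obtain x \<gamma> where x: "x \<in> T" "\<gamma> \<in> \<Gamma>" "b = mult x \<gamma> a" by blast
  then have "mult t \<delta> b = mult (mult t \<delta> x) \<gamma> a" using * assms mult_assoc by simp
  then show "mult t \<delta> b \<in> {mult t \<gamma> a | t \<gamma>. t \<in> T \<and> \<gamma> \<in> \<Gamma>}"
    using x * mult_closed by blast
qed (use assms T_nonempty Gamma_nonempty mult_closed in blast)+

end

section \<open>0-least left ideals and their translates\<close>

context gamma_semigroup_with_zero
begin

lemma zero_least_left_idealD:
  assumes "zero_least_left_ideal L"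
  shows "left_ideal L" "L \<subseteq> T"
  using assms left_idealD(2) unfolding zero_least_left_ideal_def by auto

lemma zero_least_left_ideal_eq:
  assumes "zero_least_left_ideal L" "left_ideal C" "C \<subseteq> L" "c \<in> C" "c \<noteq> zero"
  shows "C = L"
  using assms unfolding zero_least_left_ideal_def by blast

lemma zero_least_left_ideal_nonzero:
  assumes "zero_least_left_ideal L"
  obtains l where "l \<in> L" "l \<noteq> zero"
  using assms left_idealD(1) unfolding zero_least_left_ideal_def by blast

text \<open>A left ideal inside the translate pulls back along right multiplication by
  \<open>s\<close> to a left ideal inside \<open>L\<close>. If it has a non-zero element, so does
  the pullback, which is then all of \<open>L\<close> by minimality.\<close>

lemma zero_least_left_ideal_translate:
  assumes L: "zero_least_left_ideal L" and s: "\<gamma> \<in> \<Gamma>" "s \<in> T"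
    and l: "l \<in> L" "mult l \<gamma> s \<noteq> zero"
  shows "zero_least_left_ideal ((\<lambda>x. mult x \<gamma> s) ` L)" (is "zero_least_left_ideal ?M")
  unfolding zero_least_left_ideal_def
proof (intro conjI allI impI)
  note LD = left_idealD[OF zero_least_left_idealD(1)[OF L]]
  show "left_ideal ?M" using left_ideal_translate L s zero_least_left_idealD(1) by blast
  show "?M \<noteq> {zero}" using l by blast
  fix C assume C: "left_ideal C \<and> C \<subset> ?M"
  let ?D = "{x \<in> L. mult x \<gamma> s \<in> C}"
  have D: "left_ideal ?D"
  proof (rule left_idealI)
    show "?D \<noteq> {}" using C left_idealD(1) by blast
    show "?D \<subseteq> T" using LD(2) by blast
  next
    fix t \<delta> b assume *: "t \<in> T" "\<delta> \<in> \<Gamma>" "b \<in> ?D"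
    then have "mult (mult t \<delta> b) \<gamma> s = mult t \<delta> (mult b \<gamma> s)"
      using LD(2) s mult_assoc by blast
    then show "mult t \<delta> b \<in> ?D" using * LD(3) left_idealD(3) C by simp
  qed
  show "C = {zero}"
  proof (rule ccontr)
    assume "C \<noteq> {zero}"
    then obtain c where c: "c \<in> C" "c \<noteq> zero" using C left_idealD(1) by blast
    then obtain x where x: "x \<in> L" "c = mult x \<gamma> s" using C by blast
    have "x \<noteq> zero" using c x s mult_zero_left by auto
    then have "?D = L" using zero_least_left_ideal_eq[OF L D, of x] x c by blast
    then show False using C by blast
  qed
qed

end

section \<open>Left-right duality\<close>

context zero_simple_gamma_semigroup
begin

text \<open>Reversing the product exchanges left and right ideals and keeps 0-simplicity, so facts
  are proved for left ideals only and reach right ideals by interpreting the locale at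
  \<open>opp\<close>.\<close>

abbreviation (input) opp :: "'a \<Rightarrow> 'g \<Rightarrow> 'a \<Rightarrow> 'a" where
  "opp \<equiv> \<lambda>a \<gamma> b. mult b \<gamma> a"

lemma gamma_semigroup_opp: "gamma_semigroup T \<Gamma> opp"
  by unfold_locales (use T_nonempty Gamma_nonempty mult_closed mult_assoc in auto)

lemma left_ideal_opp: "gamma_semigroup.left_ideal T \<Gamma> opp = right_ideal"
  unfolding fun_eq_iff gamma_semigroup.left_ideal_def[OF gamma_semigroup_opp] right_ideal_def
    gamma_semigroup.set_mult_def[OF gamma_semigroup_opp] set_mult_def by blast

lemma right_ideal_opp: "gamma_semigroup.right_ideal T \<Gamma> opp = left_ideal"
  unfolding fun_eq_iff gamma_semigroup.right_ideal_def[OF gamma_semigroup_opp] left_ideal_def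
    gamma_semigroup.set_mult_def[OF gamma_semigroup_opp] set_mult_def by blast

lemma zero_simple_opp: "zero_simple_gamma_semigroup T \<Gamma> opp zero"
proof -
  interpret opp: gamma_semigroup T \<Gamma> opp by (rule gamma_semigroup_opp)
  have "opp.set_mult T T = set_mult T T"
    unfolding opp.set_mult_def set_mult_def by blast
  then show ?thesis
    using zero_in_T mult_zero_left mult_zero_right square_nonzero only_two_sided_ideals
    by unfold_locales
      (auto simp: opp.two_sided_ideal_def left_ideal_opp right_ideal_opp two_sided_ideal_def)
qed

lemma with_zero_opp: "gamma_semigroup_with_zero T \<Gamma> opp zero"
  using zero_simple_opp unfolding zero_simple_gamma_semigroup_def by simp

lemma zero_least_left_ideal_opp:
  "gamma_semigroup_with_zero.zero_least_left_ideal T \<Gamma> opp zero = zero_least_right_ideal"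
  unfolding fun_eq_iff zero_least_right_ideal_def
    gamma_semigroup_with_zero.zero_least_left_ideal_def[OF with_zero_opp] left_ideal_opp by simp

text \<open>Reversal merely swaps the two equations in \<open>idem_le\<close>, together with their
  witnesses.\<close>

lemma primitive_idempotent_opp:
  "gamma_semigroup_with_zero.primitive_idempotent T \<Gamma> opp zero = primitive_idempotent"
  unfolding fun_eq_iff primitive_idempotent_def idempotent_def idem_le_def
    gamma_semigroup_with_zero.primitive_idempotent_def[OF with_zero_opp]
    gamma_semigroup.idempotent_def[OF gamma_semigroup_opp]
    gamma_semigroup.idem_le_def[OF gamma_semigroup_opp] by blast

section \<open>Factorizations in a 0-simple semigroup\<close>

lemma ex_nonzero_product: "\<exists>x\<in>T. \<exists>\<gamma>\<in>\<Gamma>. \<exists>y\<in>T. mult x \<gamma> y \<noteq> zero"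
proof (rule ccontr)
  assume "\<not> ?thesis"
  then have "set_mult T T \<subseteq> {zero}" unfolding set_mult_def by blast
  moreover have "set_mult T T \<noteq> {}"
    using T_nonempty Gamma_nonempty unfolding set_mult_def by blast
  ultimately show False using square_nonzero by blast
qed

lemma ex_factorization2:
  assumes "t \<in> T"
  shows "\<exists>x\<in>T. \<exists>\<gamma>\<in>\<Gamma>. \<exists>y\<in>T. t = mult x \<gamma> y"
proof -
  have "two_sided_ideal (set_mult T T)"
    by (rule two_sided_idealI)
      (use ex_nonzero_product mult_closed in \<open>unfold set_mult_def, blast+\<close>)
  then have "set_mult T T = T" using only_two_sided_ideals square_nonzero by blast
  then show ?thesis using assms unfolding set_mult_def by blast
qed

text \<open>The elements all of whose sandwiches vanish form a two-sided ideal \<open>?A\<close>. A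
  non-zero member would make it \<open>T\<close>; splitting the left factor of any product then
  turns the product into a sandwich, so all products would vanish.\<close>

lemma ex_sandwich_nonzero:
  assumes "a \<in> T" "a \<noteq> zero"
  shows "\<exists>x\<in>T. \<exists>\<gamma>\<in>\<Gamma>. \<exists>\<delta>\<in>\<Gamma>. \<exists>y\<in>T. mult (mult x \<gamma> a) \<delta> y \<noteq> zero"
proof (rule ccontr)
  let ?A = "{a \<in> T. \<forall>x\<in>T. \<forall>\<gamma>\<in>\<Gamma>. \<forall>\<delta>\<in>\<Gamma>. \<forall>y\<in>T. mult (mult x \<gamma> a) \<delta> y = zero}"
  assume "\<not> ?thesis"
  then have a: "a \<in> ?A" using assms by blast
  have "two_sided_ideal ?A"
  proof (rule two_sided_idealI)
    show "?A \<noteq> {}" using a by blast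
    show "?A \<subseteq> T" by blast
  next
    fix t \<beta> b assume *: "t \<in> T" "\<beta> \<in> \<Gamma>" "b \<in> ?A"
    have "mult (mult x \<gamma> (mult t \<beta> b)) \<delta> y = zero"
      if "x \<in> T" "\<gamma> \<in> \<Gamma>" "\<delta> \<in> \<Gamma>" "y \<in> T" for x \<gamma> \<delta> y
    proof -
      have "mult (mult x \<gamma> (mult t \<beta> b)) \<delta> y = mult (mult (mult x \<gamma> t) \<beta> b) \<delta> y"
        using * that mult_assoc by simp
      then show ?thesis using * that mult_closed by simp
    qed
    then show "mult t \<beta> b \<in> ?A" using * mult_closed by blast
    have "mult (mult x \<gamma> (mult b \<beta> t)) \<delta> y = zero"
      if "x \<in> T" "\<gamma> \<in> \<Gamma>" "\<delta> \<in> \<Gamma>" "y \<in> T" for x \<gamma> \<delta> y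
    proof -
      have "mult (mult x \<gamma> (mult b \<beta> t)) \<delta> y = mult (mult x \<gamma> b) \<beta> (mult t \<delta> y)"
        using * that mult_assoc mult_closed by simp
      then show ?thesis using * that mult_closed by simp
    qed
    then show "mult b \<beta> t \<in> ?A" using * mult_closed by blast
  qed
  then have A: "?A = T" using only_two_sided_ideals a assms(2) by blast
  obtain x \<gamma> y where xy: "x \<in> T" "\<gamma> \<in> \<Gamma>" "y \<in> T" "mult x \<gamma> y \<noteq> zero"
    using ex_nonzero_product by blast
  obtain p \<delta> q where pq: "p \<in> T" "\<delta> \<in> \<Gamma>" "q \<in> T" "x = mult p \<delta> q"
    using ex_factorization2 xy(1) by blast
  have "q \<in> ?A" using A pq by simp
  then have "mult (mult p \<delta> q) \<gamma> y = zero" using pq(1,2) xy(2,3) by blast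
  then show False using pq xy by simp
qed

text \<open>The sandwiches of \<open>a\<close> form a two-sided ideal, and
  \<open>ex_sandwich_nonzero\<close> rules out \<open>{zero}\<close>.\<close>

lemma ex_sandwich:
  assumes a: "a \<in> T" "a \<noteq> zero" and t: "t \<in> T"
  obtains x \<gamma> \<delta> y where "x \<in> T" "\<gamma> \<in> \<Gamma>" "\<delta> \<in> \<Gamma>" "y \<in> T" "t = mult (mult x \<gamma> a) \<delta> y"
proof -
  let ?J = "{mult (mult x \<gamma> a) \<delta> y | x \<gamma> \<delta> y. x \<in> T \<and> \<gamma> \<in> \<Gamma> \<and> \<delta> \<in> \<Gamma> \<and> y \<in> T}"
  have "two_sided_ideal ?J"
  proof (rule two_sided_idealI)
    show "?J \<noteq> {}" using T_nonempty Gamma_nonempty by blast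
    show "?J \<subseteq> T" using mult_closed a by blast
  next
    fix t \<beta> b assume *: "t \<in> T" "\<beta> \<in> \<Gamma>" "b \<in> ?J"
    then obtain x \<gamma> \<delta> y
      where x: "x \<in> T" "\<gamma> \<in> \<Gamma>" "\<delta> \<in> \<Gamma>" "y \<in> T" "b = mult (mult x \<gamma> a) \<delta> y"
      by blast
    have "mult t \<beta> b = mult (mult (mult t \<beta> x) \<gamma> a) \<delta> y"
      using * x a mult_assoc mult_closed by simp
    then show "mult t \<beta> b \<in> ?J" using * x mult_closed by blast
    have "mult b \<beta> t = mult (mult x \<gamma> a) \<delta> (mult y \<beta> t)"
      using * x a mult_assoc mult_closed by simp
    then show "mult b \<beta> t \<in> ?J" using * x mult_closed by blast
  qed
  moreover have "?J \<noteq> {zero}" using ex_sandwich_nonzero[OF a] by blast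
  ultimately have "?J = T" using only_two_sided_ideals by blast
  then show ?thesis using t that by blast
qed

text \<open>A primeness property. Factor \<open>b\<close> through \<open>a\<close>, then the right
  factor \<open>y\<close> through \<open>b\<close>: this exhibits a product from \<open>a\<close> to
  \<open>b\<close> as an inner factor of \<open>b\<close>, which is non-zero.\<close>

lemma ex_between_nonzero:
  assumes a: "a \<in> T" "a \<noteq> zero" and b: "b \<in> T" "b \<noteq> zero"
  obtains \<gamma> s \<delta> where "\<gamma> \<in> \<Gamma>" "s \<in> T" "\<delta> \<in> \<Gamma>" "mult (mult a \<gamma> s) \<delta> b \<noteq> zero"
proof -
  obtain x \<gamma> \<delta> y where x: "x \<in> T" "\<gamma> \<in> \<Gamma>" "\<delta> \<in> \<Gamma>" "y \<in> T" "b = mult (mult x \<gamma> a) \<delta> y"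
    using ex_sandwich[OF a b(1)] .
  obtain p \<gamma>' \<delta>' q
    where p: "p \<in> T" "\<gamma>' \<in> \<Gamma>" "\<delta>' \<in> \<Gamma>" "q \<in> T" "y = mult (mult p \<gamma>' b) \<delta>' q"
    using ex_sandwich[OF b x(4)] .
  have "b = mult (mult x \<gamma> (mult (mult a \<delta> p) \<gamma>' b)) \<delta>' q"
    using x p(1-4) a b by (subst x(5), subst p(5)) (simp only: mult_assoc mult_closed)
  then have "mult (mult a \<delta> p) \<gamma>' b \<noteq> zero"
    using b(2) x p mult_zero_left mult_zero_right by metis
  then show ?thesis using that x p by blast
qed

section \<open>Multiplication inside a 0-least left ideal\<close>

lemma zero_least_left_ideal_generated:
  assumes L: "zero_least_left_ideal L" and a: "a \<in> L" "a \<noteq> zero" and b: "b \<in> L"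
  obtains t \<gamma> where "t \<in> T" "\<gamma> \<in> \<Gamma>" "b = mult t \<gamma> a"
proof -
  let ?C = "{mult t \<gamma> a | t \<gamma>. t \<in> T \<and> \<gamma> \<in> \<Gamma>}"
  note LD = left_idealD[OF zero_least_left_idealD(1)[OF L]]
  have aT: "a \<in> T" using LD a by blast
  obtain x \<gamma> \<delta> y where x: "x \<in> T" "\<gamma> \<in> \<Gamma>" "\<delta> \<in> \<Gamma>" "y \<in> T" "a = mult (mult x \<gamma> a) \<delta> y"
    using ex_sandwich[OF aT a(2) aT] .
  \<comment> \<open>\<open>?C\<close> is not known to contain \<open>a\<close>, so another non-zero
    member is needed: if \<open>x \<gamma> a\<close> vanished, so would \<open>a\<close>.\<close>
  have "mult x \<gamma> a \<noteq> zero" using x a(2) mult_zero_left by metis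
  moreover have "?C \<subseteq> L" using LD(3) a by blast
  ultimately have "?C = L"
    using zero_least_left_ideal_eq[OF L left_ideal_principal[OF aT]] x by blast
  then show ?thesis using that b by blast
qed

text \<open>Right multiplication by \<open>a\<close> through \<beta> maps \<open>L\<close> onto
  \<open>L\<close>, since the image is a left ideal inside \<open>L\<close> containing the non-zero
  \<open>a \<beta> a\<close>. Taking a preimage of \<open>a\<close>, and then one of that preimage,
  gives \<open>v\<close>.\<close>

lemma zero_least_left_ideal_square_factor:
  assumes L: "zero_least_left_ideal L" and a: "a \<in> L" "\<beta> \<in> \<Gamma>" "mult a \<beta> a \<noteq> zero"
  obtains v where "v \<in> T" "a = mult v \<beta> (mult a \<beta> a)"
proof -
  note LD = left_idealD[OF zero_least_left_idealD(1)[OF L]]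
  let ?C = "(\<lambda>x. mult x \<beta> a) ` L"
  have aT: "a \<in> T" using LD a by blast
  have "?C \<subseteq> L" using LD(2,3) a by blast
  then have C: "?C = L"
    using zero_least_left_ideal_eq[OF L left_ideal_translate] zero_least_left_idealD(1)[OF L] a aT
    by blast
  obtain t where t: "t \<in> L" "a = mult t \<beta> a" using C a(1) by blast
  obtain v where v: "v \<in> L" "t = mult v \<beta> a" using C t(1) by blast
  have "a = mult v \<beta> (mult a \<beta> a)" using t v LD(2) aT a mult_assoc by (metis subsetD)
  then show ?thesis using that v LD(2) by blast
qed

lemma zero_least_left_ideal_idem_right_unit:
  assumes L: "zero_least_left_ideal L" and e: "e \<in> L"
    and f: "f \<in> L" "f \<noteq> zero" "\<delta> \<in> \<Gamma>" "mult f \<delta> f = f"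
  shows "mult e \<delta> f = e"
proof -
  obtain t \<gamma> where "t \<in> T" "\<gamma> \<in> \<Gamma>" "e = mult t \<gamma> f"
    using zero_least_left_ideal_generated[OF L f(1,2) e] .
  then show ?thesis using mult_assoc f zero_least_left_idealD(2)[OF L] by (metis subsetD)
qed

section \<open>Primitive idempotents generate 0-least left ideals\<close>

lemma primitive_idempotent_left_inverse:
  assumes e: "primitive_idempotent e" "\<alpha> \<in> \<Gamma>" "mult e \<alpha> e = e"
    and a: "a \<in> T" "a \<noteq> zero" "mult e \<alpha> a = a" "mult a \<alpha> e = a"
  obtains z \<gamma> where "z \<in> T" "\<gamma> \<in> \<Gamma>" "e = mult z \<gamma> a"
proof -
  have eT: "e \<in> T" "e \<noteq> zero" using e unfolding primitive_idempotent_def idempotent_def by auto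
  obtain x \<gamma> \<delta> y where x: "x \<in> T" "\<gamma> \<in> \<Gamma>" "\<delta> \<in> \<Gamma>" "y \<in> T" "e = mult (mult x \<gamma> a) \<delta> y"
    using ex_sandwich[OF a(1,2) eT(1)] .
  \<comment> \<open>Inserting \<open>e\<close> replaces the connecting \<gamma> and \<delta> by
    \<alpha>, at no cost because \<open>a\<close> absorbs \<open>e\<close> through \<alpha> on both
    sides.\<close>
  let ?x = "mult x \<gamma> e" and ?y = "mult (mult e \<delta> y) \<alpha> e"
  have xT: "?x \<in> T" and yT: "?y \<in> T" using x e eT mult_closed by auto
  have "mult (mult ?x \<alpha> a) \<alpha> ?y = mult (mult (mult x \<gamma> (mult e \<alpha> a)) \<alpha> e) \<delta> (mult y \<alpha> e)"
    using x e(2) eT a(1) by (simp only: mult_assoc mult_closed)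
  also have "\<dots> = mult (mult x \<gamma> (mult (mult e \<alpha> a) \<alpha> e)) \<delta> (mult y \<alpha> e)"
    using x e(2) eT a(1) by (simp only: mult_assoc mult_closed)
  also have "\<dots> = mult (mult (mult x \<gamma> a) \<delta> y) \<alpha> e"
    using x(1-4) e(2) eT a by (simp only: mult_assoc mult_closed)
  finally have xay: "mult (mult ?x \<alpha> a) \<alpha> ?y = e" using x(5) e(3) by simp
  have ey: "mult e \<alpha> ?y = ?y" and ye: "mult ?y \<alpha> e = ?y"
    using x e eT mult_assoc mult_closed by metis+
  \<comment> \<open>A cyclic rotation of \<open>?x \<alpha> a \<alpha> ?y = e\<close>: in its square
    the middle factor collapses to \<open>e\<close>, which \<open>?y\<close> absorbs.\<close>
  let ?g = "mult ?y \<alpha> (mult ?x \<alpha> a)"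
  have gT: "?g \<in> T" using xT yT a e mult_closed by simp
  have "mult ?g \<alpha> ?g = mult ?y \<alpha> (mult (mult (mult ?x \<alpha> a) \<alpha> ?y) \<alpha> (mult ?x \<alpha> a))"
    using xT yT a(1) e(2) by (simp only: mult_assoc mult_closed)
  also have "\<dots> = mult (mult ?y \<alpha> e) \<alpha> (mult ?x \<alpha> a)"
    unfolding xay using xT yT a(1) e(2) eT(1) by (simp only: mult_assoc mult_closed)
  finally have gg: "mult ?g \<alpha> ?g = ?g" unfolding ye .
  \<comment> \<open>Multiplying \<open>?g\<close> on both sides recovers \<open>e\<close>, so
    \<open>?g\<close> cannot vanish.\<close>
  have "mult (mult (mult ?x \<alpha> a) \<alpha> ?g) \<alpha> ?y
      = mult (mult (mult ?x \<alpha> a) \<alpha> ?y) \<alpha> (mult (mult ?x \<alpha> a) \<alpha> ?y)"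
    using xT yT a(1) e(2) by (simp only: mult_assoc mult_closed)
  then have xgy: "mult (mult (mult ?x \<alpha> a) \<alpha> ?g) \<alpha> ?y = e" unfolding xay e(3) .
  have g0: "?g \<noteq> zero"
  proof
    assume g: "?g = zero"
    have "mult (mult (mult ?x \<alpha> a) \<alpha> ?g) \<alpha> ?y = zero"
      unfolding g using xT yT a(1) e(2) by (simp only: mult_zero_left mult_zero_right mult_closed)
    then show False using xgy eT(2) by simp
  qed
  have eg: "mult e \<alpha> ?g = mult (mult e \<alpha> ?y) \<alpha> (mult ?x \<alpha> a)"
    and ge: "mult ?g \<alpha> e = mult ?y \<alpha> (mult ?x \<alpha> (mult a \<alpha> e))"
    using xT yT a(1) e(2) eT(1) by (simp_all only: mult_assoc mult_closed)
  have "idempotent ?g" "idem_le ?g e"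
    using gT gg e(2) eg[unfolded ey] ge[unfolded a(4)]
    unfolding idempotent_def idem_le_def by blast+
  \<comment> \<open>Since \<open>?g\<close> ends in \<open>a\<close>, having \<open>e\<close> below
    \<open>?g\<close> makes \<open>e\<close> a left multiple of \<open>a\<close>.\<close>
  then have "idem_le e ?g" using e(1) g0 unfolding primitive_idempotent_def by blast
  then obtain \<beta> where b: "\<beta> \<in> \<Gamma>" "mult e \<beta> ?g = e" unfolding idem_le_def by blast
  have "mult e \<beta> ?g = mult (mult (mult e \<beta> ?y) \<alpha> ?x) \<alpha> a"
    using xT yT a(1) e(2) eT(1) b(1) by (simp only: mult_assoc mult_closed)
  then have "e = mult (mult (mult e \<beta> ?y) \<alpha> ?x) \<alpha> a" using b(2) by simp
  moreover have "mult (mult e \<beta> ?y) \<alpha> ?x \<in> T"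
    using xT yT e(2) eT(1) b(1) by (simp only: mult_closed)
  ultimately show ?thesis using that e(2) by blast
qed

lemma primitive_idempotent_zero_least_left_ideal:
  assumes e: "primitive_idempotent e"
  shows "zero_least_left_ideal {mult t \<gamma> e | t \<gamma>. t \<in> T \<and> \<gamma> \<in> \<Gamma>}" (is "zero_least_left_ideal ?L")
proof -
  obtain \<alpha> where \<alpha>: "\<alpha> \<in> \<Gamma>" "mult e \<alpha> e = e" and eT: "e \<in> T" "e \<noteq> zero"
    using e unfolding primitive_idempotent_def idempotent_def by blast
  have "C = {zero}" if C: "left_ideal C" "C \<subset> ?L" for C
  proof (rule ccontr)
    note CD = left_idealD[OF C(1)]
    assume "C \<noteq> {zero}"
    then obtain b where b: "b \<in> C" "b \<noteq> zero" using CD(1) by blast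
    then have bT: "b \<in> T" using CD(2) by blast
    obtain t \<gamma>' where t: "t \<in> T" "\<gamma>' \<in> \<Gamma>" "b = mult t \<gamma>' e" using b C by blast
    have be: "mult b \<alpha> e = b" using t \<alpha> eT mult_assoc by simp
    obtain x \<gamma> \<delta> y where x: "x \<in> T" "\<gamma> \<in> \<Gamma>" "\<delta> \<in> \<Gamma>" "y \<in> T" "e = mult (mult x \<gamma> b) \<delta> y"
      using ex_sandwich[OF bT b(2) eT(1)] .
    \<comment> \<open>\<open>b\<close> absorbs \<open>e\<close> only on the right. Left
      multiplication stays in \<open>C\<close>, secures absorption on the left as well, and keeps
      \<open>?a\<close> non-zero because \<open>?a \<delta> y = e\<close>.\<close>
    let ?a = "mult e \<alpha> (mult x \<gamma> b)"
    have xbT: "mult x \<gamma> b \<in> T" using x bT mult_closed by simp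
    have aC: "?a \<in> C" using CD(3) b eT \<alpha> x by simp
    then have aT: "?a \<in> T" using CD(2) by blast
    have ea: "mult e \<alpha> ?a = ?a" using mult_assoc[OF eT(1) eT(1) xbT \<alpha>(1) \<alpha>(1)] \<alpha>(2) by simp
    have "mult ?a \<alpha> e = mult e \<alpha> (mult x \<gamma> (mult b \<alpha> e))"
      using \<alpha>(1) eT(1) x(1-4) bT by (simp only: mult_assoc mult_closed)
    then have ae: "mult ?a \<alpha> e = ?a" using be by simp
    have "mult ?a \<delta> y = e" using mult_assoc[OF eT(1) xbT x(4) \<alpha>(1) x(3)] x(5) \<alpha>(2) by simp
    then have "?a \<noteq> zero" using eT x mult_zero_left by metis
    then obtain z \<beta> where "z \<in> T" "\<beta> \<in> \<Gamma>" "e = mult z \<beta> ?a"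
      using primitive_idempotent_left_inverse[OF e \<alpha> aT _ ea ae] by blast
    then have "e \<in> C" using CD(3) aC by metis
    then show False using CD(3) C(2) by blast
  qed
  moreover have "e \<in> ?L" using \<alpha> eT by force
  ultimately show ?thesis
    unfolding zero_least_left_ideal_def using left_ideal_principal[OF eT(1)] eT(2) by blast
qed

section \<open>From 0-least ideals to a primitive idempotent\<close>

lemma ex_common_square_nonzero:
  assumes L: "zero_least_left_ideal L" and R: "zero_least_right_ideal R"
  obtains M a \<beta> where "zero_least_left_ideal M" "a \<in> M" "a \<in> R" "\<beta> \<in> \<Gamma>" "mult a \<beta> a \<noteq> zero"
proof -
  interpret opp: zero_simple_gamma_semigroup T \<Gamma> opp zero by (rule zero_simple_opp)
  have R': "opp.zero_least_left_ideal R" using R zero_least_left_ideal_opp by simp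
  note RD = opp.left_idealD[OF opp.zero_least_left_idealD(1)[OF R']]
  obtain l where l: "l \<in> L" "l \<noteq> zero" using L zero_least_left_ideal_nonzero by blast
  obtain r where r: "r \<in> R" "r \<noteq> zero" using R' opp.zero_least_left_ideal_nonzero by blast
  have lT: "l \<in> T" using l zero_least_left_idealD(2)[OF L] by blast
  have rT: "r \<in> T" using r RD by blast
  obtain \<gamma> s \<delta> where s: "\<gamma> \<in> \<Gamma>" "s \<in> T" "\<delta> \<in> \<Gamma>" "mult (mult l \<gamma> s) \<delta> r \<noteq> zero"
    using ex_between_nonzero[OF lT l(2) rT r(2)] .
  \<comment> \<open>Passing from \<open>L\<close> to its translate \<open>?M\<close> absorbs
    \<open>s\<close>, leaving a non-zero product \<open>?m \<delta> r\<close> of a member of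
    \<open>?M\<close> and a member of \<open>R\<close>.\<close>
  let ?m = "mult l \<gamma> s" and ?M = "(\<lambda>x. mult x \<gamma> s) ` L"
  have m0: "?m \<noteq> zero" using s mult_zero_left rT by metis
  have M: "zero_least_left_ideal ?M"
    using zero_least_left_ideal_translate[OF L s(1,2) l(1) m0] .
  note MD = left_idealD[OF zero_least_left_idealD(1)[OF M]]
  have m: "?m \<in> ?M" using l by blast
  then have mT: "?m \<in> T" using MD(2) by blast
  obtain \<gamma>' t \<delta>'
    where t: "\<gamma>' \<in> \<Gamma>" "t \<in> T" "\<delta>' \<in> \<Gamma>" "mult (mult r \<gamma>' t) \<delta>' ?m \<noteq> zero"
    using ex_between_nonzero[OF rT r(2) mT m0] .
  \<comment> \<open>It begins with \<open>r\<close> and ends with \<open>?m\<close>, so it lies in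
    both ideals.\<close>
  let ?a = "mult (mult r \<gamma>' t) \<delta>' ?m"
  have aM: "?a \<in> ?M" using MD(3) m t mult_closed rT by simp
  then have aT: "?a \<in> T" using MD(2) by blast
  have aR: "?a \<in> R" using RD(3) r t mT by simp
  obtain p \<pi> where p: "p \<in> T" "\<pi> \<in> \<Gamma>" "?m = mult p \<pi> ?a"
    using zero_least_left_ideal_generated[OF M aM t(4) m] .
  obtain q \<rho> where q: "q \<in> T" "\<rho> \<in> \<Gamma>" "r = mult ?a \<rho> q"
    using opp.zero_least_left_ideal_generated[OF R' aR t(4) r(1)] .
  \<comment> \<open>As \<open>?m\<close> is a left multiple and \<open>r\<close> a right multiple of
    \<open>?a\<close>, the non-zero \<open>?m \<delta> r\<close> has \<open>?a \<delta> ?a\<close>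
    as an inner factor.\<close>
  have "mult (mult p \<pi> ?a) \<delta> (mult ?a \<rho> q) = mult (mult p \<pi> (mult ?a \<delta> ?a)) \<rho> q"
    using p(1,2) q(1,2) aT s(3) mult_assoc[of _ "?a"] mult_assoc[of p] mult_closed by simp
  then have "mult ?m \<delta> r = mult (mult p \<pi> (mult ?a \<delta> ?a)) \<rho> q" using p(3) q(3) by argo
  then have "mult ?a \<delta> ?a \<noteq> zero"
    using s(4) p q mult_zero_left mult_zero_right by metis
  then show ?thesis using that[OF M aM aR s(3)] by blast
qed

lemma zero_least_ideals_primitive_idempotent:
  assumes "zero_least_left_ideal L" and R: "zero_least_right_ideal R"
  shows "\<exists>e. primitive_idempotent e"
proof -
  interpret opp: zero_simple_gamma_semigroup T \<Gamma> opp zero by (rule zero_simple_opp)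
  have R': "opp.zero_least_left_ideal R" using R zero_least_left_ideal_opp by simp
  note RD = opp.left_idealD[OF opp.zero_least_left_idealD(1)[OF R']]
  obtain M a \<beta> where M: "zero_least_left_ideal M"
    and a: "a \<in> M" "a \<in> R" "\<beta> \<in> \<Gamma>" "mult a \<beta> a \<noteq> zero"
    using ex_common_square_nonzero[OF assms] .
  note MD = left_idealD[OF zero_least_left_idealD(1)[OF M]]
  have aT: "a \<in> T" using a MD(2) by blast
  obtain v where v: "v \<in> T" "a = mult v \<beta> (mult a \<beta> a)"
    using zero_least_left_ideal_square_factor[OF M a(1,3,4)] .
  obtain w where w: "w \<in> T" "a = mult (mult a \<beta> a) \<beta> w"
    using opp.zero_least_left_ideal_square_factor[OF R' a(2,3,4)] .
  let ?e = "mult v \<beta> a"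
  \<comment> \<open>Bracketing \<open>v \<beta> a \<beta> a \<beta> w\<close> in two ways identifies
    \<open>v \<beta> a\<close> with \<open>a \<beta> w\<close>, placing \<open>?e\<close> in both
    \<open>M\<close> and \<open>R\<close>.\<close>
  have "mult (mult v \<beta> (mult a \<beta> a)) \<beta> w = mult v \<beta> (mult (mult a \<beta> a) \<beta> w)"
    using v(1) w(1) aT a(3) by (simp only: mult_assoc mult_closed)
  then have ew: "?e = mult a \<beta> w" using v(2) w(2) by simp
  have eM: "?e \<in> M" using MD(3) v a by simp
  have eR: "?e \<in> R" using RD(3) w a ew by simp
  have eT: "?e \<in> T" using eM MD(2) by blast
  have "mult ?e \<beta> a = a" using v aT a(3) mult_assoc by simp
  then have e0: "?e \<noteq> zero" using a aT mult_zero_left by metis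
  have "mult ?e \<beta> ?e = mult v \<beta> (mult a \<beta> (mult a \<beta> w))"
    unfolding ew[symmetric] using v(1) aT eT a(3) by (simp only: mult_assoc mult_closed)
  also have "\<dots> = ?e" using w aT a(3) mult_assoc by simp
  finally have ee: "mult ?e \<beta> ?e = ?e" .
  have "idem_le ?e f" if f: "idempotent f" "f \<noteq> zero" "idem_le f ?e" for f
  proof -
    obtain \<delta> where d: "f \<in> T" "\<delta> \<in> \<Gamma>" "mult f \<delta> f = f" using f unfolding idempotent_def by blast
    obtain x y where xy: "x \<in> \<Gamma>" "y \<in> \<Gamma>" "mult f x ?e = f" "mult ?e y f = f"
      using f unfolding idem_le_def by blast
    \<comment> \<open>Being below \<open>?e\<close> puts \<open>f\<close> in both ideals, where it
      is a right unit for \<open>M\<close> and a left unit for \<open>R\<close>, through the same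
      \<delta>.\<close>
    have "f \<in> M" using MD(3)[OF d(1) xy(1) eM] xy(3) by simp
    moreover have "f \<in> R" using RD(3)[OF d(1) xy(2) eR] xy(4) by simp
    ultimately have "mult ?e \<delta> f = ?e" "mult f \<delta> ?e = ?e"
      using zero_least_left_ideal_idem_right_unit[OF M eM _ f(2) d(2,3)]
        opp.zero_least_left_ideal_idem_right_unit[OF R' eR _ f(2) d(2,3)] by blast+
    then show ?thesis using d(2) unfolding idem_le_def by blast
  qed
  then have "primitive_idempotent ?e"
    unfolding primitive_idempotent_def idempotent_def using eT e0 ee a(3) by blast
  then show ?thesis by blast
qed

end

theorem theorem5p2:
  fixes T :: "'a set" and \<Gamma> :: "'g set" and mult :: "'a \<Rightarrow> 'g \<Rightarrow> 'a \<Rightarrow> 'a" and zero :: 'a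
  assumes "zero_simple_gamma_semigroup T \<Gamma> mult zero"
  shows "completely_zero_simple_gamma_semigroup T \<Gamma> mult zero \<longleftrightarrow>
    (\<exists>L. gamma_semigroup_with_zero.zero_least_left_ideal T \<Gamma> mult zero L) \<and>
    (\<exists>R. gamma_semigroup_with_zero.zero_least_right_ideal T \<Gamma> mult zero R)"
proof -
  interpret zero_simple_gamma_semigroup T \<Gamma> mult zero by (rule assms)
  interpret opp: zero_simple_gamma_semigroup T \<Gamma> opp zero by (rule zero_simple_opp)
  have "completely_zero_simple_gamma_semigroup T \<Gamma> mult zero \<longleftrightarrow> (\<exists>e. primitive_idempotent e)"
    using assms unfolding completely_zero_simple_gamma_semigroup_def
      completely_zero_simple_gamma_semigroup_axioms_def by blast
  also have "\<dots> \<longleftrightarrow> (\<exists>L. zero_least_left_ideal L) \<and> (\<exists>R. zero_least_right_ideal R)"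
    using primitive_idempotent_zero_least_left_ideal zero_least_ideals_primitive_idempotent
      opp.primitive_idempotent_zero_least_left_ideal
    unfolding primitive_idempotent_opp zero_least_left_ideal_opp by blast
  finally show ?thesis .
qed

end
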